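(* For the linear compatible relaxation system, let $C\in[C_-,C_+]$, $T>0$, $u_0\in X_h$ (independent of $\delta$), and let the initial data be $U_0^\delta=(u_0,q_0^{[3]})^T$ with $$q_0^{[3]}=-aG_hu_0-a^2\delta\,G_h(G_h^*G_h)u_0-2a^3\delta^2\,G_h(G_h^*G_h)^2u_0-5a^4\delta^3\,G_h(G_h^*G_h)^3u_0.$$ Then the numerical solution $U_{h,\delta}^n=R(\Delta tA_{h,\delta})^nU_0^\delta$ and the exact semi-discrete solution $U_{h,\delta}(t)=e^{tA_{h,\delta}}U_0^\delta$ satisfy $$\sup_{0<\delta\le\delta_0}\ \max_{0\le n\Delta t\le T}\|U_{h,\delta}^n-U_{h,\delta}(t_n)\|\le K_{h,T}\,\Delta t^4,\qquad t_n=n\Delta t,$$ with $K_{h,T}$ independent of $\delta$ and $\Delta t$.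
   Context: The spatial discretization is fixed: finite-dimensional Hilbert spaces $X_h,Q_h$, a constant $a>0$, and linear maps $G_h:X_h\to Q_h$, $D_h:Q_h\to X_h$ with $D_h=-G_h^*$. On $X_h\times Q_h$ put $$A_{h,\delta}=\begin{bmatrix}0&-D_h\\-(a/\delta)G_h&-(1/\delta)I\end{bmatrix};$$ the relaxation system is $U_t=A_{h,\delta}U$, $U=(u,q)^T$. The number $\delta_0>0$ is fixed with $4a\delta_0\sigma_{\max}^2<1$, where $\sigma_{\max}$ is the largest nonzero singular value of $G_h$. Set $C_\pm=\frac{25\pm\sqrt{105}}{780}$, $a_0=\frac16+\frac72C$, $a_1=\frac23-10C$, $a_2=\frac16+\frac{13}2C$, $H(z)=\frac{1+z/4+z^2/48}{1-z/4+z^2/48}$ and $R(z)=\frac{1+a_0z+Cz^2+(a_1z-Cz^2)H(z)}{1-a_2z+\frac32Cz^2}$; $R(M)$ is the rational function of the operator $M$. The constant $K_{h,T}$ may depend on the discretization, on $T$, and on the size of $u_0$. *)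

theory Defs
  imports "HOL-Analysis.Analysis" "HOL-Computational_Algebra.Polynomial"
begin

definition op_poly :: "real poly \<Rightarrow> ('v::real_vector \<Rightarrow> 'v) \<Rightarrow> 'v \<Rightarrow> 'v" where
  "op_poly p M x = (\<Sum>k\<le>degree p. coeff p k *\<^sub>R (M ^^ k) x)"

text \<open>
  The quotient \<open>p(M) / q(M)\<close>; meaningful only where \<open>q(M)\<close> is bijective. For the linear
  relaxation operators below, the spectrum lies in \<open>(-\<infinity>, 0]\<close> when
  \<open>4 a \<delta> \<sigma>\<^sub>m\<^sub>a\<^sub>x\<^sup>2 < 1\<close>, and the denominators used here are positive there.
\<close>
definition op_frac :: "real poly \<Rightarrow> real poly \<Rightarrow> ('v::real_vector \<Rightarrow> 'v) \<Rightarrow> 'v \<Rightarrow> 'v" where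
  "op_frac p q M x = inv (op_poly q M) (op_poly p M x)"

definition op_exp :: "('v::real_normed_vector \<Rightarrow> 'v) \<Rightarrow> 'v \<Rightarrow> 'v" where
  "op_exp M x = (\<Sum>k. (M ^^ k) x /\<^sub>R fact k)"

definition singular_values :: "('x::euclidean_space \<Rightarrow> 'q::euclidean_space) \<Rightarrow> real set" where
  "singular_values G = {\<sigma>. \<sigma> \<ge> 0 \<and> (\<exists>v. v \<noteq> 0 \<and> adjoint G (G v) = \<sigma>\<^sup>2 *\<^sub>R v)}"

text \<open>For \<open>G = 0\<close>, where there is no nonzero singular value, the value is \<open>0\<close>.\<close>
definition sigma_max :: "('x::euclidean_space \<Rightarrow> 'q::euclidean_space) \<Rightarrow> real" where
  "sigma_max G =
     (if singular_values G - {0} = {} then 0 else Max (singular_values G - {0}))"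

definition relax_op ::
  "real \<Rightarrow> real \<Rightarrow> ('x::euclidean_space \<Rightarrow> 'q::euclidean_space) \<Rightarrow> ('q \<Rightarrow> 'x) \<Rightarrow> 'x \<times> 'q \<Rightarrow> 'x \<times> 'q"
where
  "relax_op a \<delta> G D = (\<lambda>(u, q). (- D q, - (a / \<delta>) *\<^sub>R G u - (1 / \<delta>) *\<^sub>R q))"

definition init_flux ::
  "real \<Rightarrow> real \<Rightarrow> ('x::euclidean_space \<Rightarrow> 'q::euclidean_space) \<Rightarrow> 'x \<Rightarrow> 'q"
where
  "init_flux a \<delta> G u =
     - a *\<^sub>R G u
     - (a^2 * \<delta>) *\<^sub>R G ((adjoint G \<circ> G) u)
     - (2 * a^3 * \<delta>^2) *\<^sub>R G (((adjoint G \<circ> G) ^^ 2) u)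
     - (5 * a^4 * \<delta>^3) *\<^sub>R G (((adjoint G \<circ> G) ^^ 3) u)"

definition C_minus :: real where "C_minus = (25 - sqrt 105) / 780"
definition C_plus :: real where "C_plus = (25 + sqrt 105) / 780"

definition coef_a0 :: "real \<Rightarrow> real" where "coef_a0 C = 1/6 + 7/2 * C"
definition coef_a1 :: "real \<Rightarrow> real" where "coef_a1 C = 2/3 - 10 * C"
definition coef_a2 :: "real \<Rightarrow> real" where "coef_a2 C = 1/6 + 13/2 * C"

text \<open>
  \<open>H(M)\<close> and \<open>R(M)\<close> for
  \<open>H(z) = (1 + z/4 + z\<^sup>2/48) / (1 - z/4 + z\<^sup>2/48)\<close> and
  \<open>R(z) = (1 + a\<^sub>0 z + C z\<^sup>2 + (a\<^sub>1 z - C z\<^sup>2) H(z)) / (1 - a\<^sub>2 z + 3/2 C z\<^sup>2)\<close>.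
\<close>
definition H_op :: "('v::real_vector \<Rightarrow> 'v) \<Rightarrow> 'v \<Rightarrow> 'v" where
  "H_op M = op_frac [:1, 1/4, 1/48:] [:1, -1/4, 1/48:] M"

definition R_op :: "real \<Rightarrow> ('v::real_vector \<Rightarrow> 'v) \<Rightarrow> 'v \<Rightarrow> 'v" where
  "R_op C M x =
     inv (op_poly [:1, - coef_a2 C, 3/2 * C:] M)
       (op_poly [:1, coef_a0 C, C:] M x + op_poly [:0, coef_a1 C, - C:] M (H_op M x))"

end

theory Submission
  imports Defs
begin

text \<open>
  On the span of \<open>(b, 0)\<close> and \<open>(0, G b)\<close>, where \<open>G\<^sup>* G b = l b\<close> with \<open>l > 0\<close>, the relaxation operator has
  a slow eigenvalue \<open>\<mu>\<close>, bounded in \<open>\<delta>\<close>, and a fast eigenvalue \<open>\<nu>\<close> with \<open>\<bar>\<nu>\<bar> \<le> 1/\<delta>\<close>. Both are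
  nonpositive, and the eigenvectors are \<open>(b, (z/l) G b)\<close> for \<open>z = \<mu>, \<nu>\<close>. The initial flux is the Catalan series of
  \<open>\<mu>/l\<close> truncated after \<open>\<delta>\<^sup>3\<close>, so the fast component of the initial data has
  coefficient \<open>O(\<delta>\<^sup>5)\<close>.

  For \<open>z \<le> 0\<close> one has \<open>\<bar>R(z)\<^sup>n - exp(n z)\<bar> \<le> 8 z\<^sup>4\<close> for every \<open>n\<close>: the one-step error is
  \<open>O(z\<^sup>5)\<close>, \<open>\<bar>R(z)\<bar> \<le> 1\<close>, and the geometric sum of the \<open>exp(k z)\<close> is \<open>O(1/\<bar>z\<bar>)\<close>. With \<open>z = \<Delta>t \<mu>\<close> this gives
  \<open>O(\<Delta>t\<^sup>4)\<close> at once; with \<open>z = \<Delta>t \<nu>\<close> the factor \<open>\<delta>\<^sup>-\<^sup>4\<close> from \<open>\<nu>\<^sup>4\<close>, and the further factor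
  \<open>\<delta>\<^sup>-\<^sup>1\<close> in the norm of the fast eigenvector, are absorbed by the \<open>O(\<delta>\<^sup>5)\<close> coefficient.

  The \<open>u\<^sub>0\<close> for which such a uniform bound exists form a subspace that contains all eigenvectors of
  \<open>G\<^sup>* G\<close>, hence the whole space.
\<close>

subsection \<open>Spectra of symmetric operators and functions of operators\<close>

text \<open>A maximizer \<open>v\<close> of the Rayleigh quotient on the unit sphere of
  \<open>S\<close> is an eigenvector: the residual \<open>L v - l v\<close> lies in \<open>S\<close>
  by invariance, and the first variation in its direction forces it to vanish.\<close>

lemma symmetric_eigenvector_in_subspace:
  fixes L :: "'a::euclidean_space \<Rightarrow> 'a"
  assumes L: "linear L" and sym: "\<And>x y. L x \<bullet> y = x \<bullet> L y"
    and S: "subspace S" "L ` S \<subseteq> S" "S \<noteq> {0}"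
  obtains v l where "v \<in> S" "v \<noteq> 0" "L v = l *\<^sub>R v"
proof -
  interpret L: linear L by fact
  let ?K = "S \<inter> sphere 0 1"
  obtain s where s: "s \<in> S" "s \<noteq> 0"
    using S subspace_0 by blast
  then have "s /\<^sub>R norm s \<in> ?K"
    using S(1) by (simp add: subspace_scale)
  moreover have "compact ?K"
    by (simp add: S(1) closed_Int_compact closed_subspace)
  moreover have "continuous_on ?K (\<lambda>x. x \<bullet> L x)"
    by (intro continuous_intros linear_continuous_on) (simp add: L linear_conv_bounded_linear[symmetric])
  ultimately obtain v where v: "v \<in> ?K" and vmax: "\<And>x. x \<in> ?K \<Longrightarrow> x \<bullet> L x \<le> v \<bullet> L v"
    using continuous_attains_sup[of ?K "\<lambda>x. x \<bullet> L x"] by blast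
  define l where "l = v \<bullet> L v"
  have vS: "v \<in> S" and v1: "v \<bullet> v = 1"
    using v by (auto simp: norm_eq_1)
  have rayleigh: "x \<bullet> L x \<le> l * (x \<bullet> x)" if "x \<in> S" for x
  proof (cases "x = 0")
    case False
    then have "x /\<^sub>R norm x \<in> ?K"
      using S(1) that by (simp add: subspace_scale)
    from vmax[OF this] have "(x \<bullet> L x) / (norm x)\<^sup>2 \<le> l"
      by (simp add: L.scale l_def power2_eq_square divide_inverse mult_ac)
    then show ?thesis
      using False by (simp add: field_simps power2_norm_eq_inner)
  qed (simp add: L.zero)
  define w where "w = L v - l *\<^sub>R v"
  have wS: "w \<in> S"
    unfolding w_def using S vS by (intro subspace_diff subspace_scale) auto
  define c where "c = l * (w \<bullet> w) - w \<bullet> L w"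
  \<comment> \<open>Rayleigh's bound at \<open>v + t w\<close>: the terms of order zero and those
    with \<open>w \<bullet> v\<close> cancel, and what remains at first order is
    \<open>2 * t * (w \<bullet> w)\<close>.\<close>
  have quad: "2 * t * (w \<bullet> w) \<le> t\<^sup>2 * c" for t
  proof -
    have "v + t *\<^sub>R w \<in> S"
      using S(1) vS wS by (intro subspace_add subspace_scale)
    from rayleigh[OF this]
    have "v \<bullet> L v + 2 * t * (w \<bullet> L v) + t\<^sup>2 * (w \<bullet> L w)
        \<le> l * (v \<bullet> v + 2 * t * (w \<bullet> v) + t\<^sup>2 * (w \<bullet> w))"
      by (simp add: L.add L.scale inner_add_left inner_add_right inner_commute[of v w]
          sym[of v w, symmetric] inner_commute[of "L v" w] algebra_simps power2_eq_square)
    moreover have wLv: "w \<bullet> L v = w \<bullet> w + l * (w \<bullet> v)"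
      by (subst (3) w_def) (simp add: inner_diff_right)
    ultimately show ?thesis
      unfolding wLv by (simp add: c_def v1 l_def[symmetric] algebra_simps)
  qed
  have "w \<bullet> w = 0"
  proof (rule ccontr)
    assume "w \<bullet> w \<noteq> 0"
    then have pos: "w \<bullet> w > 0" by simp
    \<comment> \<open>Small enough that the quadratic term \<open>t * c\<close> stays below
      \<open>w \<bullet> w\<close>, which contradicts \<open>quad\<close>.\<close>
    define t where "t = (w \<bullet> w) / (\<bar>c\<bar> + 1)"
    have t: "t > 0" unfolding t_def using pos by simp
    have "t * (2 * (w \<bullet> w)) \<le> t * (t * c)"
      using quad[of t] by (simp add: power2_eq_square mult_ac)
    then have "2 * (w \<bullet> w) \<le> t * c"
      using t by simp
    also have "\<dots> \<le> t * (\<bar>c\<bar> + 1)"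
      using t by (intro mult_left_mono) auto
    also have "\<dots> = w \<bullet> w"
      unfolding t_def by simp
    finally show False using pos by simp
  qed
  then have "L v = l *\<^sub>R v" by (simp add: w_def)
  moreover have "v \<noteq> 0" using v1 by auto
  ultimately show thesis using vS that by blast
qed

text \<open>By symmetry the orthogonal complement of the span is again invariant under
  \<open>L\<close>. Were it nonzero, it would contain an eigenvector, which would then be orthogonal
  to itself.\<close>

lemma symmetric_span_eigenvectors:
  fixes L :: "'a::euclidean_space \<Rightarrow> 'a"
  assumes L: "linear L" and sym: "\<And>x y. L x \<bullet> y = x \<bullet> L y"
  shows "span {v. \<exists>l. L v = l *\<^sub>R v} = UNIV"
proof (rule ccontr)
  interpret L: linear L by fact
  let ?E = "{v. \<exists>l. L v = l *\<^sub>R v}"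
  let ?S = "{y. \<forall>x\<in>span ?E. orthogonal y x}"
  assume "span ?E \<noteq> UNIV"
  then have "span ?E \<subset> span UNIV" by auto
  then obtain x where "x \<noteq> 0" "\<And>y. y \<in> span ?E \<Longrightarrow> orthogonal x y"
    using orthogonal_to_subspace_exists_gen[of ?E UNIV] by blast
  then have ne: "?S \<noteq> {0}" by auto
  have sub: "subspace ?S"
    by (auto simp: subspace_def orthogonal_clauses)
  have inv: "L x \<in> span ?E" if "x \<in> span ?E" for x
  proof -
    have "L v \<in> span ?E" if "L v = l *\<^sub>R v" for v l
      unfolding that using that by (intro span_scale span_base) auto
    then have "span (L ` ?E) \<subseteq> span ?E"
      by (intro span_minimal) auto
    then show ?thesis
      using that by (auto simp: linear_span_image[OF L])
  qed
  have im: "L ` ?S \<subseteq> ?S"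
    using inv by (auto simp: orthogonal_def sym)
  obtain v l where v: "v \<in> ?S" "v \<noteq> 0" "L v = l *\<^sub>R v"
    by (rule symmetric_eigenvector_in_subspace[OF L sym sub im ne])
  then have "v \<in> span ?E" by (intro span_base) auto
  then show False using v by (auto simp: orthogonal_self)
qed

text \<open>Eigenvectors of distinct eigenvalues are orthogonal, and pairwise orthogonal sets are
  finite here. Through this the maximum in \<open>sigma_max\<close> is one over a finite
  set.\<close>

lemma symmetric_finite_spectrum:
  fixes L :: "'a::euclidean_space \<Rightarrow> 'a"
  assumes sym: "\<And>x y. L x \<bullet> y = x \<bullet> L y"
  shows "finite {l. \<exists>v. v \<noteq> 0 \<and> L v = l *\<^sub>R v}" (is "finite ?S")
proof -
  have "\<forall>l\<in>?S. \<exists>v. v \<noteq> 0 \<and> L v = l *\<^sub>R v" by simp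
  then obtain e where e: "\<And>l. l \<in> ?S \<Longrightarrow> e l \<noteq> 0 \<and> L (e l) = l *\<^sub>R e l"
    unfolding bchoice_iff by blast
  have orth: "orthogonal (e l) (e m)" if "l \<in> ?S" "m \<in> ?S" "l \<noteq> m" for l m
    using e[OF that(1)] e[OF that(2)] sym[of "e l" "e m"] that(3)
    by (auto simp: orthogonal_def)
  then have "inj_on e ?S"
    by (metis (no_types, lifting) e inj_onI orthogonal_self)
  moreover have "pairwise orthogonal (e ` ?S)"
    using orth by (auto simp: pairwise_def)
  then have "finite (e ` ?S)"
    by (rule pairwise_orthogonal_imp_finite)
  ultimately show ?thesis
    using finite_imageD by blast
qed

section \<open>Polynomials, inverses and exponentials of operators on eigenvectors\<close>

lemma funpow_linear: "linear M \<Longrightarrow> linear (M ^^ k)" for M :: "'v::real_vector \<Rightarrow> 'v"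
  by (induction k) (auto simp: linear_id linear_compose)

lemma funpow_eigen:
  "linear M \<Longrightarrow> M e = z *\<^sub>R e \<Longrightarrow> (M ^^ k) e = z ^ k *\<^sub>R e" for M :: "'v::real_vector \<Rightarrow> 'v"
  by (induction k) (auto simp: linear_scale)

lemma linear_op_poly: "linear M \<Longrightarrow> linear (op_poly p M)"
  unfolding op_poly_def
  by (intro linear_compose_sum ballI linear_compose_scale_right funpow_linear)

lemma op_poly_eigen: "linear M \<Longrightarrow> M e = z *\<^sub>R e \<Longrightarrow> op_poly p M e = poly p z *\<^sub>R e"
  by (simp add: op_poly_def poly_altdef funpow_eigen[of M e z] scaleR_sum_left)

text \<open>Each admissible eigenvector is the image of itself divided by \<open>poly q z\<close>,
  so the range contains a spanning set; in finite dimension surjectivity gives injectivity. Hence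
  \<open>inv (op_poly q M)\<close> is a true inverse.\<close>

lemma inj_op_poly:
  fixes M :: "'v::euclidean_space \<Rightarrow> 'v"
  assumes M: "linear M" and span: "span {e. \<exists>z. M e = z *\<^sub>R e \<and> poly q z \<noteq> 0} = UNIV"
  shows "inj (op_poly q M)"
proof -
  let ?f = "op_poly q M"
  have "e \<in> range ?f" if "M e = z *\<^sub>R e" "poly q z \<noteq> 0" for e z
    using that op_poly_eigen[OF M, of "e /\<^sub>R poly q z" z q] M
    by (intro image_eqI[of _ _ "e /\<^sub>R poly q z"]) (auto simp: linear_scale)
  then have "span {e. \<exists>z. M e = z *\<^sub>R e \<and> poly q z \<noteq> 0} \<subseteq> range ?f"
    by (intro span_minimal linear_subspace_image linear_op_poly[OF M] subspace_UNIV) auto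
  then show ?thesis
    using span linear_surjective_imp_injective[OF linear_op_poly[OF M]] by auto
qed

lemma inv_op_poly_eigen:
  fixes M :: "'v::euclidean_space \<Rightarrow> 'v"
  assumes "linear M" "inj (op_poly q M)" "M e = z *\<^sub>R e" "poly q z \<noteq> 0"
  shows "inv (op_poly q M) (c *\<^sub>R e) = (c / poly q z) *\<^sub>R e"
  using assms by (intro inv_f_eq) (auto simp: op_poly_eigen[of M e z] linear_scale[OF linear_op_poly])

lemma summable_op_exp:
  fixes M :: "'v::euclidean_space \<Rightarrow> 'v"
  assumes M: "linear M"
  shows "summable (\<lambda>k. (M ^^ k) x /\<^sub>R fact k)"
proof -
  obtain b where b: "\<And>x. norm (M x) \<le> b * norm x"
    using linear_bounded[OF M] by blast
  \<comment> \<open>The constant \<open>b\<close> comes without a sign, so its absolute value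
    dominates the powers of \<open>M\<close>.\<close>
  have bn: "norm (M y) \<le> \<bar>b\<bar> * norm y" for y
    by (meson abs_ge_self b mult_right_mono norm_ge_zero order_trans)
  have pow: "norm ((M ^^ k) x) \<le> \<bar>b\<bar> ^ k * norm x" for k
  proof (induction k)
    case (Suc k)
    have "norm ((M ^^ Suc k) x) \<le> \<bar>b\<bar> * norm ((M ^^ k) x)" using bn by simp
    also have "\<dots> \<le> \<bar>b\<bar> * (\<bar>b\<bar> ^ k * norm x)" using Suc by (intro mult_left_mono) auto
    finally show ?case by simp
  qed simp
  show ?thesis
  proof (rule summable_comparison_test')
    show "summable (\<lambda>k. (\<bar>b\<bar> ^ k /\<^sub>R fact k) * norm x)"
      by (intro summable_mult2 summable_exp_generic)
    show "norm ((M ^^ k) x /\<^sub>R fact k) \<le> (\<bar>b\<bar> ^ k /\<^sub>R fact k) * norm x" if "k \<ge> 0" for k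
      using mult_left_mono[OF pow[of k], of "inverse (fact k)"] by (simp add: mult_ac)
  qed
qed

lemma linear_op_exp:
  fixes M :: "'v::euclidean_space \<Rightarrow> 'v"
  assumes M: "linear M"
  shows "linear (op_exp M)"
proof (rule linearI)
  show "op_exp M (x + y) = op_exp M x + op_exp M y" for x y
    unfolding op_exp_def
    by (subst suminf_add) (simp_all add: summable_op_exp M linear_add[OF funpow_linear] scaleR_add_right)
  show "op_exp M (c *\<^sub>R x) = c *\<^sub>R op_exp M x" for c x
    unfolding op_exp_def
    using suminf_scaleR_right[OF summable_op_exp[OF M], of c x]
    by (simp add: M linear_scale[OF funpow_linear] mult.commute[of c])
qed

lemma op_exp_eigen:
  fixes M :: "'v::euclidean_space \<Rightarrow> 'v"
  assumes "linear M" "M e = z *\<^sub>R e"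
  shows "op_exp M e = exp z *\<^sub>R e"
proof -
  have "op_exp M e = (\<Sum>k. (z ^ k /\<^sub>R fact k) *\<^sub>R e)"
    unfolding op_exp_def using funpow_eigen[OF assms] by (simp add: mult_ac)
  also have "\<dots> = exp z *\<^sub>R e"
    unfolding exp_def by (rule suminf_scaleR_left[symmetric]) (rule summable_exp_generic)
  finally show ?thesis .
qed

subsection \<open>The scalar amplification factor\<close>

definition R_fun :: "real \<Rightarrow> real \<Rightarrow> real" where
  "R_fun C z =
     (1 + coef_a0 C * z + C * z\<^sup>2
        + (coef_a1 C * z - C * z\<^sup>2) * ((1 + z/4 + z\<^sup>2/48) / (1 - z/4 + z\<^sup>2/48)))
     / (1 - coef_a2 C * z + 3/2 * C * z\<^sup>2)"

text \<open>From \<open>sqrt 105 \<le> 15\<close>. All later estimates work on this larger interval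
  with rational endpoints.\<close>

lemma C_bounds:
  assumes "C \<in> {C_minus..C_plus}"
  shows "1/78 \<le> C" "C \<le> 2/39"
proof -
  have "sqrt 105 \<le> 15" by (rule real_le_lsqrt) auto
  then show "1/78 \<le> C" "C \<le> 2/39"
    using assms by (auto simp: C_minus_def C_plus_def)
qed

lemma exp_neg_taylor:
  fixes x :: real
  assumes "0 \<le> x" "x \<le> 1"
  shows "\<bar>exp (- x) - (1 - x + x\<^sup>2/2 - x^3/6 + x^4/24)\<bar> \<le> x^5"
proof -
  obtain t where t: "\<bar>t\<bar> \<le> \<bar>- x\<bar>"
    and e: "exp (- x) = (\<Sum>m<5. ((- x) ^ m) / fact m) + (exp t / fact 5) * (- x) ^ 5"
    using Maclaurin_exp_le[of "- x" 5] by blast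
  have "exp t \<le> exp 1" using t assms by simp
  then have "exp t \<le> 3" using exp_le by linarith
  then have "exp t / 120 * x^5 \<le> 1 * x^5"
    using assms by (intro mult_right_mono) auto
  moreover have "exp t / 120 * x^5 \<ge> 0" using assms by simp
  moreover have "exp (- x) - (1 - x + x\<^sup>2/2 - x^3/6 + x^4/24) = - (exp t / 120 * x^5)"
    unfolding e by (simp add: eval_nat_numeral fact_numeral)
  ultimately show ?thesis by linarith
qed

text \<open>Controls the denominator of the geometric sum of the \<open>exp (- k x)\<close>; it
  follows from \<open>exp x \<ge> 1 + x\<close>.\<close>

lemma one_minus_exp_ge:
  fixes x :: real
  assumes "0 \<le> x" "x \<le> 1"
  shows "x / 2 \<le> 1 - exp (- x)"
proof -
  have "exp (- x) \<le> 1 / (1 + x)"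
    using exp_ge_add_one_self[of x] assms by (simp add: exp_minus divide_simps)
  also have "\<dots> \<le> 1 - x / 2"
    using assms mult_left_mono[of x 1 x] by (simp add: field_simps)
  finally show ?thesis by simp
qed

text \<open>\<open>R_num C x / R_den C x\<close> is \<open>R_fun C (- x)\<close> over one common
  denominator. The quartic terms of the numerator cancel, and for \<open>C \<ge> 0\<close> all
  coefficients of \<open>R_den\<close> are nonnegative.\<close>

definition R_num :: "real \<Rightarrow> real \<Rightarrow> real" where
  "R_num C x = 1 - (7/12 - 13/2 * C) * x + (7/48 - 27/8 * C) * x\<^sup>2 - (5/288 - 61/96 * C) * x^3"

definition R_den :: "real \<Rightarrow> real \<Rightarrow> real" where
  "R_den C x = 1 + (5/12 + 13/2 * C) * x + (1/16 + 25/8 * C) * x\<^sup>2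
     + (1/288 + 49/96 * C) * x^3 + C/32 * x^4"

lemma H_den_pos:
  fixes z :: real
  assumes "z \<le> 0"
  shows "0 < 1 - z/4 + z\<^sup>2/48"
proof -
  have "z\<^sup>2 \<ge> 0" by simp
  then show ?thesis using assms by linarith
qed

lemma R_outer_den_pos:
  fixes z :: real
  assumes "0 \<le> C" "z \<le> 0"
  shows "0 < 1 - coef_a2 C * z + 3/2 * C * z\<^sup>2"
proof -
  have "coef_a2 C * z \<le> 0"
    using assms by (intro mult_nonneg_nonpos) (auto simp: coef_a2_def)
  moreover have "C * z\<^sup>2 \<ge> 0" using assms by simp
  ultimately show ?thesis by linarith
qed

lemma R_den_ge_1: "0 \<le> C \<Longrightarrow> 0 \<le> x \<Longrightarrow> 1 \<le> R_den C x"
  unfolding R_den_def by (smt (verit) mult_nonneg_nonneg zero_le_power divide_nonneg_nonneg)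

lemma R_fun_eq:
  assumes C: "0 \<le> C" and x: "0 \<le> x"
  shows "R_fun C (- x) = R_num C x / R_den C x"
proof -
  define h where "h = 1 + x/4 + x\<^sup>2/48"
  define d where "d = 1 + coef_a2 C * x + 3/2 * C * x\<^sup>2"
  have h: "h > 0" using H_den_pos[of "- x"] x by (simp add: h_def)
  have d: "d > 0" using R_outer_den_pos[of C "- x"] C x by (simp add: d_def)
  have "R_fun C (- x)
      = (1 - coef_a0 C * x + C * x\<^sup>2 + (- coef_a1 C * x - C * x\<^sup>2) * ((1 - x/4 + x\<^sup>2/48) / h)) / d"
    by (simp add: R_fun_def h_def d_def)
  also have "\<dots> = ((1 - coef_a0 C * x + C * x\<^sup>2) * h + (- coef_a1 C * x - C * x\<^sup>2) * (1 - x/4 + x\<^sup>2/48)) / (d * h)"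
    using h d by (simp add: field_simps)
  also have "(1 - coef_a0 C * x + C * x\<^sup>2) * h + (- coef_a1 C * x - C * x\<^sup>2) * (1 - x/4 + x\<^sup>2/48) = R_num C x"
    unfolding h_def R_num_def coef_a0_def coef_a1_def by (simp add: field_simps eval_nat_numeral)
  also have "d * h = R_den C x"
    unfolding h_def d_def R_den_def coef_a2_def by (simp add: field_simps eval_nat_numeral)
  finally show ?thesis .
qed

text \<open>Both \<open>R_den - R_num\<close> and \<open>R_den + R_num\<close> have nonnegative
  coefficients in \<open>x\<close>. The bound \<open>1/78 \<le> C\<close> is exactly the sign
  condition on \<open>13/2 * C - 1/12\<close>.\<close>

lemma abs_R_fun_le_1:
  assumes C: "1/78 \<le> C" "C \<le> 2/39" and x: "0 \<le> x"
  shows "\<bar>R_fun C (- x)\<bar> \<le> 1"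
proof -
  have "0 \<le> x + (13/2 * C - 1/12) * x\<^sup>2 + (1/48 - C/8) * x^3 + C/32 * x^4"
    using C x by (intro add_nonneg_nonneg mult_nonneg_nonneg) auto
  also have "\<dots> = R_den C x - R_num C x"
    by (simp add: R_den_def R_num_def algebra_simps)
  finally have 1: "R_num C x \<le> R_den C x" by simp
  have "0 \<le> 2 + (13 * C - 1/6) * x + (5/24 - C/4) * x\<^sup>2 + (110/96 * C - 4/288) * x^3 + C/32 * x^4"
    using C x by (intro add_nonneg_nonneg mult_nonneg_nonneg) auto
  also have "\<dots> = R_den C x + R_num C x"
    by (simp add: R_den_def R_num_def algebra_simps)
  finally have 2: "- R_num C x \<le> R_den C x" by simp
  have "R_den C x \<ge> 1" using R_den_ge_1 C x by simp
  with 1 2 show ?thesis using C x by (simp add: R_fun_eq abs_le_iff divide_simps)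
qed

text \<open>After multiplication by the denominator, the defect against the Taylor polynomial
  \<open>P\<close> contributes \<open>x^5\<close> and the Taylor remainder, scaled by
  \<open>R_den \<le> 3\<close>, contributes \<open>3 * x^5\<close>. Dividing by
  \<open>R_den \<ge> 1\<close> costs nothing.\<close>

lemma R_fun_local_error:
  assumes C: "1/78 \<le> C" "C \<le> 2/39" and x: "0 \<le> x" "x \<le> 1"
  shows "\<bar>R_fun C (- x) - exp (- x)\<bar> \<le> 4 * x^5"
proof -
  define P where "P = 1 - x + x\<^sup>2/2 - x^3/6 + x^4/24"
  have P: "\<bar>exp (- x) - P\<bar> \<le> x^5" unfolding P_def by (rule exp_neg_taylor[OF x])
  have pw: "0 \<le> x^k \<and> x^k \<le> 1" for k using x by (simp add: power_le_one)
  have cpw: "0 \<le> C * x^k \<and> C * x^k \<le> 2/39" for k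
    using mult_mono[of C "2/39" "x^k" 1] pw[of k] C by simp
  have D1: "R_den C x \<ge> 1" using R_den_ge_1 C x by simp
  have D3: "R_den C x \<le> 3"
    using cpw[of 1] cpw[of 2] cpw[of 3] cpw[of 4] pw[of 1] pw[of 2] pw[of 3]
    unfolding R_den_def by (simp add: algebra_simps) 
  \<comment> \<open>The quotient of \<open>R_den * P - R_num\<close> by \<open>x^5\<close>; the
    cancellation of all lower powers is the fourth-order consistency of \<open>R\<close>.\<close>
  define g where "g = (5/576 - 5/192 * C) + (7/3456 + 35/576 * C) * x
    + (1/6912 + 37/2304 * C) * x\<^sup>2 + C/768 * x^3"
  \<comment> \<open>Expanded into monomials, each of which has a bound in \<open>pw\<close> or
    \<open>cpw\<close>, so that linear arithmetic suffices.\<close>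
  have "g = 5/576 - 5/192 * C + 7/3456 * x + 35/576 * (C * x) + 1/6912 * x\<^sup>2
    + 37/2304 * (C * x\<^sup>2) + 1/768 * (C * x^3)"
    by (simp add: g_def algebra_simps)
  moreover have "0 \<le> C * x" "C * x \<le> 2/39"
    using cpw[of 1] by simp_all
  ultimately have g: "\<bar>g\<bar> \<le> 1"
    using cpw[of 2] cpw[of 3] pw[of 2] x C by linarith
  have "R_den C x * P - R_num C x = x^5 * g"
    unfolding R_den_def R_num_def P_def g_def by (simp add: field_simps eval_nat_numeral)
  then have "\<bar>R_num C x - R_den C x * P\<bar> = x^5 * \<bar>g\<bar>"
    unfolding abs_minus_commute[of "R_num C x"] using x by (simp add: abs_mult)
  also have "\<dots> \<le> x^5" using g x by (simp add: mult_left_le)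
  finally have N: "\<bar>R_num C x - R_den C x * P\<bar> \<le> x^5" .
  have "\<bar>R_den C x * (exp (- x) - P)\<bar> \<le> 3 * x^5"
    using D1 D3 P by (auto simp: abs_mult intro!: mult_mono)
  with N have "\<bar>R_num C x - R_den C x * exp (- x)\<bar> \<le> 4 * x^5"
    by (simp add: algebra_simps)
  moreover have "R_fun C (- x) - exp (- x) = (R_num C x - R_den C x * exp (- x)) / R_den C x"
    using D1 C x by (simp add: R_fun_eq field_simps)
  moreover have "\<bar>b / R_den C x\<bar> \<le> \<bar>b\<bar>" for b
    using D1 by (simp add: divide_le_eq mult_left_le abs_div_pos[symmetric] mult_le_cancel_left1)
  ultimately show ?thesis by (metis order_trans)
qed

text \<open>The decay of the exponential compensates the number of steps, so the bound is free of
  \<open>n\<close>; the constant is the local 4 times the 2 from the geometric sum.\<close>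

lemma R_fun_global_error:
  assumes C: "1/78 \<le> C" "C \<le> 2/39" and z: "z \<le> 0"
  shows "\<bar>R_fun C z ^ n - exp (real n * z)\<bar> \<le> 8 * z^4"
proof -
  define x where "x = - z"
  have x: "x \<ge> 0" and zx: "z = - x" using z by (auto simp: x_def)
  define r where "r = R_fun C z"
  define e where "e = exp z"
  have r: "\<bar>r\<bar> \<le> 1" using abs_R_fun_le_1[OF C x] by (simp add: r_def zx)
  have e: "0 < e" "e \<le> 1" using z by (auto simp: e_def)
  have en: "exp (real n * z) = e ^ n" by (simp add: e_def exp_of_nat_mult)
  have "\<bar>r ^ n - e ^ n\<bar> \<le> 8 * x^4"
  proof (cases "x = 0 \<or> x > 1")
    \<comment> \<open>For \<open>x > 1\<close> both powers have modulus at most 1, so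
      \<open>8 * x^4\<close> is ample. The value \<open>x = 0\<close> is split off because
      \<open>2 / x\<close> needs \<open>x > 0\<close>.\<close>
    case True
    then show ?thesis
    proof
      assume "x = 0"
      then show ?thesis by (simp add: r_def e_def zx R_fun_def)
    next
      assume "x > 1"
      then have "x^4 \<ge> 1" by simp
      moreover have "\<bar>r ^ n\<bar> \<le> 1" using r by (simp add: power_abs power_le_one)
      moreover have "0 \<le> e ^ n" "e ^ n \<le> 1" using e by (auto simp: power_le_one)
      ultimately show ?thesis by linarith
    qed
  next
    case False
    then have x': "0 < x" "x \<le> 1" using x by auto
    have e2: "x / 2 \<le> 1 - e" using one_minus_exp_ge[of x] x' by (simp add: e_def zx)
    have geo: "(\<Sum>p<n. e ^ p) \<le> 2 / x"
    proof -
      have "e \<noteq> 1" using e2 x' by auto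
      then have "(\<Sum>p<n. e ^ p) = (1 - e ^ n) / (1 - e)"
        by (simp add: sum_gp_strict)
      also have "\<dots> \<le> 1 / (x / 2)"
        using e e2 x' by (intro frac_le) (auto simp: power_le_one)
      finally show ?thesis by simp
    qed
    have sum: "\<bar>\<Sum>p<n. e ^ p * r ^ (n - Suc p)\<bar> \<le> 2 / x"
    proof -
      have "\<bar>e ^ p * r ^ k\<bar> \<le> e ^ p" for p k
        using e r by (simp add: abs_mult power_abs mult_left_le power_le_one)
      then have "\<bar>\<Sum>p<n. e ^ p * r ^ (n - Suc p)\<bar> \<le> (\<Sum>p<n. e ^ p)"
        by (intro order.trans[OF sum_abs sum_mono]) auto
      with geo show ?thesis by linarith
    qed
    \<comment> \<open>Telescoping of a difference of powers; the library identity is stated for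
      successors, so \<open>n = 0\<close> is separate.\<close>
    have "\<bar>r ^ n - e ^ n\<bar> = \<bar>e - r\<bar> * \<bar>\<Sum>p<n. e ^ p * r ^ (n - Suc p)\<bar>"
    proof (cases n)
      case (Suc m)
      then show ?thesis
        using diff_power_eq_sum[of e m r]
        by (simp only: abs_minus_commute[of "r ^ Suc m"] abs_mult diff_Suc_Suc)
    qed simp
    also have "\<dots> \<le> (4 * x^5) * (2 / x)"
      using R_fun_local_error[OF C, of x] x' sum
      by (intro mult_mono) (auto simp: r_def e_def zx abs_minus_commute)
    also have "\<dots> = 8 * x^4" using x' by (simp add: eval_nat_numeral)
    finally show ?thesis .
  qed
  moreover have "x^4 = z^4" by (simp add: zx)
  ultimately show ?thesis unfolding en r_def by simp
qed

text \<open>The coefficients 1, 1, 2, 5 are Catalan numbers, and \<open>r\<close> is the small root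
  of \<open>r\<^sup>2 - r + y\<close>. The cofactor \<open>1 - p - r\<close> stays at least 1/8 even
  at \<open>4 * y = 1\<close>, since \<open>r \<le> 1/2\<close> and \<open>p \<le> 3/8\<close>; 600
  exceeds 8 times 73.\<close>

lemma catalan_bound:
  fixes y :: real
  assumes "0 \<le> y" "4 * y \<le> 1"
  shows "\<bar>(1 - sqrt (1 - 4 * y)) / 2 - (y + y\<^sup>2 + 2 * y^3 + 5 * y^4)\<bar> \<le> 600 * y^5"
proof -
  define r where "r = (1 - sqrt (1 - 4 * y)) / 2"
  define p where "p = y + y\<^sup>2 + 2 * y^3 + 5 * y^4"
  have "1 - 2 * r = sqrt (1 - 4 * y)" by (simp add: r_def field_simps)
  then have "(1 - 2 * r)\<^sup>2 = 1 - 4 * y" using assms by simp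
  then have r: "r\<^sup>2 - r + y = 0" by (simp add: power2_eq_square algebra_simps)
  have "r \<le> 1/2" using assms by (simp add: r_def)
  moreover have "p \<le> 3/8"
  proof -
    have pw: "y^k \<le> (1/4)^k" for k using assms by (intro power_mono) auto
    show ?thesis using pw[of 1] pw[of 2] pw[of 3] pw[of 4]
      by (simp add: p_def power_divide)
  qed
  ultimately have gap: "1 - p - r \<ge> 1/8" by simp
  have pw: "0 \<le> y^k \<and> y^k \<le> 1" for k using assms by (simp add: power_le_one)
  \<comment> \<open>\<open>r\<close> is a root of \<open>r\<^sup>2 - r + y\<close>, while that quadratic at \<open>p\<close> is \<open>O(y\<^sup>5)\<close>.\<close>
  have "(r - p) * (1 - p - r) = (p\<^sup>2 - p + y) - (r\<^sup>2 - r + y)"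
    by (simp add: power2_eq_square algebra_simps)
  also have "\<dots> = y^5 * (14 + 14 * y + 20 * y\<^sup>2 + 25 * y^3)"
    unfolding r by (simp add: p_def eval_nat_numeral algebra_simps)
  finally have eq: "(r - p) * (1 - p - r) = y^5 * (14 + 14 * y + 20 * y\<^sup>2 + 25 * y^3)" .
  have "\<bar>r - p\<bar> * (1/8) \<le> \<bar>r - p\<bar> * \<bar>1 - p - r\<bar>"
    using gap by (intro mult_left_mono) auto
  also have "\<dots> = y^5 * (14 + 14 * y + 20 * y\<^sup>2 + 25 * y^3)"
    unfolding abs_mult[symmetric] eq using assms by simp
  also have "\<dots> \<le> y^5 * 73"
    using pw[of 1] pw[of 2] pw[of 3] assms by (intro mult_left_mono) auto
  finally show ?thesis using pw[of 5] by (simp add: r_def p_def)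
qed

subsection \<open>Operators spanned by eigenvectors with nonpositive eigenvalues\<close>

text \<open>The zero vector is included, as only the span matters. That this set spans is the form
  in which diagonalizability with spectrum in the nonpositive reals is used.\<close>

definition nonpos_eigenvectors :: "('v::real_vector \<Rightarrow> 'v) \<Rightarrow> 'v set" where
  "nonpos_eigenvectors M = {e. \<exists>z\<le>0. M e = z *\<^sub>R e}"

lemma inj_op_poly_nonpos:
  fixes M :: "'v::euclidean_space \<Rightarrow> 'v"
  assumes "linear M" and span: "span (nonpos_eigenvectors M) = UNIV"
    and q: "\<And>z. z \<le> 0 \<Longrightarrow> poly q z \<noteq> 0"
  shows "inj (op_poly q M)"
proof (rule inj_op_poly)
  have "nonpos_eigenvectors M \<subseteq> {e. \<exists>z. M e = z *\<^sub>R e \<and> poly q z \<noteq> 0}"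
    using q by (auto simp: nonpos_eigenvectors_def)
  then show "span {e. \<exists>z. M e = z *\<^sub>R e \<and> poly q z \<noteq> 0} = UNIV"
    using span span_mono by blast
qed fact

context
  fixes M :: "'v::euclidean_space \<Rightarrow> 'v" and C :: real
  assumes M: "linear M" and span: "span (nonpos_eigenvectors M) = UNIV" and C: "0 \<le> C"
begin

lemma inj_H_den: "inj (op_poly [:1, -1/4, 1/48:] M)"
proof (intro inj_op_poly_nonpos M span)
  show "poly [:1, -1/4, 1/48:] z \<noteq> 0" if "z \<le> 0" for z :: real
    using H_den_pos[OF that] by (simp add: power2_eq_square algebra_simps)
qed

lemma inj_R_outer_den: "inj (op_poly [:1, - coef_a2 C, 3/2 * C:] M)"
proof (intro inj_op_poly_nonpos M span)
  show "poly [:1, - coef_a2 C, 3/2 * C:] z \<noteq> 0" if "z \<le> 0" for z :: real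
    using R_outer_den_pos[OF C that] by (simp add: power2_eq_square algebra_simps)
qed

text \<open>Injectivity of the two denominators makes both occurrences of \<open>inv\<close> linear
  maps.\<close>

lemma linear_R_op: "linear (R_op C M)"
proof -
  have inv: "linear (inv (op_poly q M))" if "inj (op_poly q M)" for q
    using inj_linear_imp_inv_linear[OF linear_op_poly[OF M] that] .
  have H: "linear (H_op M)"
    unfolding H_op_def op_frac_def
    using linear_compose[OF linear_op_poly[OF M] inv[OF inj_H_den]] by (simp add: o_def)
  have "linear (\<lambda>x. op_poly [:1, coef_a0 C, C:] M x + op_poly [:0, coef_a1 C, - C:] M (H_op M x))"
    using linear_compose[OF H linear_op_poly[OF M]]
    by (intro linear_compose_add linear_op_poly M) (simp add: o_def)
  from linear_compose[OF this inv[OF inj_R_outer_den]] show ?thesis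
    by (simp add: R_op_def[abs_def] o_def)
qed

lemma R_op_eigen:
  assumes e: "M e = z *\<^sub>R e" and z: "z \<le> 0"
  shows "R_op C M e = R_fun C z *\<^sub>R e"
proof -
  have qH: "poly [:1, -1/4, 1/48:] z = 1 - z/4 + z\<^sup>2/48"
    and pH: "poly [:1, 1/4, 1/48:] z = 1 + z/4 + z\<^sup>2/48"
    and q: "poly [:1, - coef_a2 C, 3/2 * C:] z = 1 - coef_a2 C * z + 3/2 * C * z\<^sup>2"
    and p: "poly [:1, coef_a0 C, C:] z = 1 + coef_a0 C * z + C * z\<^sup>2"
    and p': "poly [:0, coef_a1 C, - C:] z = coef_a1 C * z - C * z\<^sup>2"
    by (simp_all add: power2_eq_square algebra_simps)
  have invH: "inv (op_poly [:1, -1/4, 1/48:] M) (c *\<^sub>R e) = (c / (1 - z/4 + z\<^sup>2/48)) *\<^sub>R e" for c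
    using inv_op_poly_eigen[OF M inj_H_den e] H_den_pos[OF z] unfolding qH by simp
  have invR: "inv (op_poly [:1, - coef_a2 C, 3/2 * C:] M) (c *\<^sub>R e)
      = (c / (1 - coef_a2 C * z + 3/2 * C * z\<^sup>2)) *\<^sub>R e" for c
    using inv_op_poly_eigen[OF M inj_R_outer_den e] R_outer_den_pos[OF C z] unfolding q by simp
  have H: "H_op M e = ((1 + z/4 + z\<^sup>2/48) / (1 - z/4 + z\<^sup>2/48)) *\<^sub>R e"
    unfolding H_op_def op_frac_def op_poly_eigen[OF M e] pH invH ..
  show ?thesis
    unfolding R_op_def R_fun_def H linear_scale[OF linear_op_poly[OF M]] op_poly_eigen[OF M e] p p'
      scaleR_scaleR scaleR_add_left[symmetric] invR
    by (simp only: mult.commute)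
qed

end

lemma nonpos_eigenvectors_scale:
  assumes "0 \<le> t"
  shows "nonpos_eigenvectors M \<subseteq> nonpos_eigenvectors (\<lambda>x. t *\<^sub>R M x)"
proof
  fix e assume "e \<in> nonpos_eigenvectors M"
  then obtain z where "z \<le> 0" "M e = z *\<^sub>R e" by (auto simp: nonpos_eigenvectors_def)
  then have "t * z \<le> 0" "t *\<^sub>R M e = (t * z) *\<^sub>R e"
    using assms by (auto simp: mult_nonneg_nonpos)
  then show "e \<in> nonpos_eigenvectors (\<lambda>x. t *\<^sub>R M x)" by (auto simp: nonpos_eigenvectors_def)
qed

lemma span_nonpos_eigenvectors_scale:
  assumes "0 \<le> t" "span (nonpos_eigenvectors M) = UNIV"
  shows "span (nonpos_eigenvectors (\<lambda>x. t *\<^sub>R M x)) = UNIV"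
  using span_mono[OF nonpos_eigenvectors_scale[OF assms(1), of M]] assms(2) by auto

text \<open>On an eigenvector both the scheme and the exact flow act as scalars, so the error is the
  scalar one at \<open>t * z\<close>.\<close>

lemma eigenvector_error:
  fixes A :: "'v::euclidean_space \<Rightarrow> 'v"
  assumes A: "linear A" and span: "span (nonpos_eigenvectors A) = UNIV"
    and C: "1/78 \<le> C" "C \<le> 2/39" and t: "0 < t" and e: "A e = z *\<^sub>R e" and z: "z \<le> 0"
  shows "norm ((R_op C (\<lambda>U. t *\<^sub>R A U) ^^ n) e - op_exp (\<lambda>U. (real n * t) *\<^sub>R A U) e)
    \<le> 8 * t^4 * z^4 * norm e"
proof -
  let ?M = "\<lambda>U. t *\<^sub>R A U"
  have M: "linear ?M" by (intro linear_compose_scale_right A)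
  have sp: "span (nonpos_eigenvectors ?M) = UNIV"
    using t span by (intro span_nonpos_eigenvectors_scale) auto
  have tz: "t * z \<le> 0" using t z by (simp add: mult_nonneg_nonpos)
  have "R_op C ?M e = R_fun C (t * z) *\<^sub>R e"
    using C tz by (intro R_op_eigen M sp) (auto simp: e)
  then have "(R_op C ?M ^^ n) e = R_fun C (t * z) ^ n *\<^sub>R e"
    using C by (intro funpow_eigen linear_R_op M sp) auto
  moreover have "op_exp (\<lambda>U. (real n * t) *\<^sub>R A U) e = exp (real n * (t * z)) *\<^sub>R e"
    by (intro op_exp_eigen linear_compose_scale_right A) (simp add: e)
  ultimately have "norm ((R_op C ?M ^^ n) e - op_exp (\<lambda>U. (real n * t) *\<^sub>R A U) e)
      = \<bar>R_fun C (t * z) ^ n - exp (real n * (t * z))\<bar> * norm e"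
    by (simp add: scaleR_diff_left[symmetric])
  also have "\<dots> \<le> (8 * (t * z)^4) * norm e"
    by (intro mult_right_mono R_fun_global_error C tz) auto
  finally show ?thesis by (simp add: power_mult_distrib mult_ac)
qed

subsection \<open>The spectrum of the relaxation operator\<close>

text \<open>\<open>slow_ev\<close> and \<open>fast_ev\<close> are the roots of
  \<open>\<delta> * z\<^sup>2 + z + a * l = 0\<close>. As \<delta> tends to 0 the first tends to
  \<open>- a * l\<close>, while the second behaves like \<open>- 1 / \<delta>\<close>.\<close>

definition slow_ev :: "real \<Rightarrow> real \<Rightarrow> real \<Rightarrow> real" where
  "slow_ev a \<delta> l = (sqrt (1 - 4 * a * \<delta> * l) - 1) / (2 * \<delta>)"

definition fast_ev :: "real \<Rightarrow> real \<Rightarrow> real \<Rightarrow> real" where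
  "fast_ev a \<delta> l = (- sqrt (1 - 4 * a * \<delta> * l) - 1) / (2 * \<delta>)"

lemma relax_ev_quadratic:
  assumes "\<delta> > 0" "4 * a * \<delta> * l \<le> 1" "z \<in> {slow_ev a \<delta> l, fast_ev a \<delta> l}"
  shows "z\<^sup>2 + z / \<delta> + a * l / \<delta> = 0"
proof -
  define s where "s = sqrt (1 - 4 * a * \<delta> * l)"
  have s: "s * s = 1 - 4 * a * \<delta> * l" using assms by (simp add: s_def)
  have "z = (s - 1) / (2 * \<delta>) \<or> z = (- s - 1) / (2 * \<delta>)"
    using assms(3) by (auto simp: slow_ev_def fast_ev_def s_def)
  then have "2 * \<delta> * z + 1 = s \<or> 2 * \<delta> * z + 1 = - s"
    using assms(1) by auto
  then have "(2 * \<delta> * z + 1) * (2 * \<delta> * z + 1) = s * s" by auto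
  then have "(4 * \<delta>) * (\<delta> * z\<^sup>2 + z + a * l) = 0"
    unfolding s by (simp add: power2_eq_square algebra_simps)
  then have "\<delta> * z\<^sup>2 + z + a * l = 0" using assms(1) by simp
  then have "(\<delta> * z\<^sup>2 + z + a * l) / \<delta> = 0" by simp
  then show ?thesis using assms(1) by (simp add: add_divide_distrib)
qed

lemma relax_ev_bounds:
  assumes "\<delta> > 0" "4 * a * \<delta> * l < 1" "0 \<le> a" "0 \<le> l"
  shows "slow_ev a \<delta> l \<le> 0" "fast_ev a \<delta> l \<le> 0"
    "\<bar>slow_ev a \<delta> l\<bar> \<le> 2 * a * l" "\<bar>fast_ev a \<delta> l\<bar> \<le> 1 / \<delta>"
    "slow_ev a \<delta> l - fast_ev a \<delta> l = sqrt (1 - 4 * a * \<delta> * l) / \<delta>"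
proof -
  define s where "s = sqrt (1 - 4 * a * \<delta> * l)"
  have s2: "s * s = 1 - 4 * a * \<delta> * l" using assms by (simp add: s_def)
  have s: "0 \<le> s" "s \<le> 1" using assms by (auto simp: s_def)
  show 1: "slow_ev a \<delta> l \<le> 0" and 2: "fast_ev a \<delta> l \<le> 0"
    using s assms by (auto simp: slow_ev_def fast_ev_def s_def[symmetric] divide_nonpos_pos)
  \<comment> \<open>Replacing \<open>s\<close> by its square yields a factor \<delta>, which cancels
    the one in the denominator of the slow eigenvalue.\<close>
  have "s * s \<le> s" using s by (simp add: mult_left_le)
  then have "1 - s \<le> 4 * a * \<delta> * l" using s2 by simp
  then have "(1 - s) / (2 * \<delta>) \<le> (4 * a * \<delta> * l) / (2 * \<delta>)"
    using assms by (intro divide_right_mono) auto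
  moreover have "slow_ev a \<delta> l = - ((1 - s) / (2 * \<delta>))"
    by (simp add: slow_ev_def s_def minus_divide_left)
  ultimately show "\<bar>slow_ev a \<delta> l\<bar> \<le> 2 * a * l"
    using assms 1 by simp
  have "(1 + s) / (2 * \<delta>) \<le> 2 / (2 * \<delta>)"
    using assms s by (intro divide_right_mono) auto
  moreover have "fast_ev a \<delta> l = - ((1 + s) / (2 * \<delta>))"
    by (simp add: fast_ev_def s_def minus_divide_left)
  ultimately show "\<bar>fast_ev a \<delta> l\<bar> \<le> 1 / \<delta>"
    using 2 by simp
  show "slow_ev a \<delta> l - fast_ev a \<delta> l = sqrt (1 - 4 * a * \<delta> * l) / \<delta>"
    unfolding slow_ev_def fast_ev_def diff_divide_distrib[symmetric] by simp
qed

context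
  fixes G :: "'x::euclidean_space \<Rightarrow> 'q::euclidean_space" and a :: real
  assumes G: "linear G" and a: "a > 0"
begin

abbreviation "relax \<delta> \<equiv> relax_op a \<delta> G (\<lambda>q. - adjoint G q)"

lemma linear_relax: "linear (relax \<delta>)"
  unfolding relax_op_def
  by (rule linearI)
    (auto simp: split_beta linear_add[OF G] linear_add[OF adjoint_linear[OF G]]
      linear_scale[OF G] linear_scale[OF adjoint_linear[OF G]] algebra_simps scaleR_diff_right)

lemma gram_symmetric: "adjoint G (G x) \<bullet> y = x \<bullet> adjoint G (G y)"
  by (simp add: adjoint_clauses[OF G])

lemma gram_eigenvalue:
  assumes "adjoint G (G b) = l *\<^sub>R b"
  shows "l * (b \<bullet> b) = G b \<bullet> G b"
  using adjoint_clauses(2)[OF G, of "G b" b] assms by simp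

lemma gram_eigenvalue_nonneg:
  assumes "adjoint G (G b) = l *\<^sub>R b" "b \<noteq> 0"
  shows "l \<ge> 0"
  using gram_eigenvalue[OF assms(1)] assms(2)
  by (metis inner_ge_zero inner_gt_zero_iff linorder_not_le mult_less_0_iff)

lemma finite_singular_values: "finite (singular_values G)"
proof -
  have "(\<lambda>s. s\<^sup>2) ` singular_values G \<subseteq> {l. \<exists>v. v \<noteq> 0 \<and> adjoint G (G v) = l *\<^sub>R v}"
    by (auto simp: singular_values_def)
  moreover have "finite {l. \<exists>v. v \<noteq> 0 \<and> adjoint G (G v) = l *\<^sub>R v}"
    by (intro symmetric_finite_spectrum gram_symmetric)
  moreover have "inj_on (\<lambda>s::real. s\<^sup>2) (singular_values G)"
    by (auto simp: inj_on_def singular_values_def)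
  ultimately show ?thesis
    using finite_subset finite_imageD by blast
qed

text \<open>For \<open>l > 0\<close> the root \<open>sqrt l\<close> is a nonzero singular value,
  hence one of those over which the maximum is taken.\<close>

lemma gram_eigenvalue_le_sigma_max:
  assumes b: "adjoint G (G b) = l *\<^sub>R b" "b \<noteq> 0"
  shows "l \<le> (sigma_max G)\<^sup>2"
proof (cases "l = 0")
  case False
  with gram_eigenvalue_nonneg[OF b] have l: "l > 0" by simp
  then have "sqrt l \<in> singular_values G - {0}"
    using b by (auto simp: singular_values_def)
  then have "sqrt l \<le> sigma_max G"
    using finite_singular_values by (auto simp: sigma_max_def)
  then show ?thesis using l real_sqrt_le_iff
    by (metis less_eq_real_def power_mono real_sqrt_ge_0_iff real_sqrt_pow2)
qed simp

text \<open>The first component fixes the flux as \<open>(z / l) *\<^sub>R G b\<close>; the second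
  component is then the quadratic equation for \<open>z\<close>.\<close>

lemma relax_eigenvector:
  assumes b: "adjoint G (G b) = l *\<^sub>R b" "l \<noteq> 0" and z: "z\<^sup>2 + z / \<delta> + a * l / \<delta> = 0"
  shows "relax \<delta> (b, (z / l) *\<^sub>R G b) = z *\<^sub>R (b, (z / l) *\<^sub>R G b)"
proof -
  have "z * z = - (z / \<delta> + a * l / \<delta>)"
    using z by (simp add: power2_eq_square)
  then have "z * (z / l) = - (z / \<delta> + a * l / \<delta>) / l"
    by simp
  also have "\<dots> = - (a / \<delta>) - (1 / \<delta>) * (z / l)"
    using b(2) by (simp add: diff_divide_distrib add_divide_distrib)
  finally have "- (a / \<delta>) - (1 / \<delta>) * (z / l) = z * (z / l)" ..
  then have "- (a / \<delta>) *\<^sub>R G b - (1 / \<delta>) *\<^sub>R (z / l) *\<^sub>R G b = (z * (z / l)) *\<^sub>R G b"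
    by (simp only: scaleR_scaleR scaleR_diff_left[symmetric])
  then show ?thesis
    using b by (simp add: relax_op_def linear_scale[OF adjoint_linear[OF G]])
qed

text \<open>Slow and fast eigenvectors together produce \<open>(b, 0)\<close> and
  \<open>(0, G b)\<close> for every Gram eigenvector \<open>b\<close>, hence all
  \<open>(x, 0)\<close> and \<open>(0, G x)\<close>. The fluxes orthogonal to the range of
  \<open>G\<close> are eigenvectors for \<open>- 1 / \<delta>\<close>.\<close>

lemma span_relax_eigenvectors:
  assumes \<delta>: "\<delta> > 0" and small: "4 * a * \<delta> * (sigma_max G)\<^sup>2 < 1"
  shows "span (nonpos_eigenvectors (relax \<delta>)) = UNIV"
proof -
  let ?S = "span (nonpos_eigenvectors (relax \<delta>))"
  let ?E = "{b. \<exists>l. adjoint G (G b) = l *\<^sub>R b}"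
  have eig: "(b, 0) \<in> ?S \<and> (0, G b) \<in> ?S" if b: "adjoint G (G b) = l *\<^sub>R b" for b l
  proof (cases "b = 0 \<or> l = 0")
    \<comment> \<open>Here \<open>G b = 0\<close>, so \<open>(b, 0)\<close> is a steady
      state.\<close>
    case True
    then have "G b = 0" using gram_eigenvalue[OF b] by auto
    moreover from this have "relax \<delta> (b, 0) = 0 *\<^sub>R (b, 0)"
      by (simp add: relax_op_def linear_0[OF adjoint_linear[OF G]])
    then have "(b, 0) \<in> nonpos_eigenvectors (relax \<delta>)"
      by (auto simp: nonpos_eigenvectors_def)
    ultimately show ?thesis by (simp add: span_base span_zero zero_prod_def[symmetric])
  next
    case False
    then have l0: "l \<noteq> 0" "b \<noteq> 0" by auto
    have l: "l \<ge> 0" using gram_eigenvalue_nonneg b l0 by blast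
    have "4 * a * \<delta> * l \<le> 4 * a * \<delta> * (sigma_max G)\<^sup>2"
      using gram_eigenvalue_le_sigma_max[OF b l0(2)] a \<delta> by (intro mult_left_mono) auto
    then have sm: "4 * a * \<delta> * l < 1" using small by simp
    let ?\<mu> = "slow_ev a \<delta> l" and ?\<nu> = "fast_ev a \<delta> l"
    note bounds = relax_ev_bounds[OF \<delta> sm less_imp_le[OF a] l]
    have "(b, (z / l) *\<^sub>R G b) \<in> ?S" if "z \<in> {?\<mu>, ?\<nu>}" for z
    proof -
      have "z \<le> 0" using that bounds(1,2) by auto
      moreover have "z\<^sup>2 + z / \<delta> + a * l / \<delta> = 0"
        using relax_ev_quadratic[of \<delta> a l z] \<delta> sm that by auto
      from relax_eigenvector[OF b l0(1) this]
      have "relax \<delta> (b, (z / l) *\<^sub>R G b) = z *\<^sub>R (b, (z / l) *\<^sub>R G b)" .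
      ultimately show ?thesis
        by (intro span_base) (auto simp: nonpos_eigenvectors_def)
    qed
    then have s: "(b, (?\<mu> / l) *\<^sub>R G b) \<in> ?S" and f: "(b, (?\<nu> / l) *\<^sub>R G b) \<in> ?S" by auto
    have ne: "?\<mu> - ?\<nu> \<noteq> 0" unfolding bounds(5) using sm \<delta> by simp
    \<comment> \<open>The difference of the two eigenvectors is a multiple of
      \<open>(0, G b)\<close>, nonzero as a multiplier because the strict smallness condition
      separates the eigenvalues.\<close>
    have "(l / (?\<mu> - ?\<nu>)) *\<^sub>R ((b, (?\<mu> / l) *\<^sub>R G b) - (b, (?\<nu> / l) *\<^sub>R G b)) \<in> ?S"
      using s f by (intro span_scale span_diff)
    also have "(l / (?\<mu> - ?\<nu>)) *\<^sub>R ((b, (?\<mu> / l) *\<^sub>R G b) - (b, (?\<nu> / l) *\<^sub>R G b))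
        = (0, ((l / (?\<mu> - ?\<nu>)) * (?\<mu> / l - ?\<nu> / l)) *\<^sub>R G b)"
      by (simp add: scaleR_diff_left[symmetric])
    also have "(l / (?\<mu> - ?\<nu>)) * (?\<mu> / l - ?\<nu> / l) = 1"
      using ne l0 by (simp add: diff_divide_distrib[symmetric])
    finally have Gb: "(0, G b) \<in> ?S" by simp
    have "(b, (?\<mu> / l) *\<^sub>R G b) - (?\<mu> / l) *\<^sub>R (0, G b) \<in> ?S"
      using s Gb by (intro span_diff span_scale)
    then show ?thesis using Gb by simp
  qed
  have all: "(x, 0) \<in> ?S \<and> (0, G x) \<in> ?S" for x
  proof -
    have "subspace {x. (x, 0) \<in> ?S \<and> (0, G x) \<in> ?S}"
    proof (rule subspaceI)
      show "0 \<in> {x. (x, 0) \<in> ?S \<and> (0, G x) \<in> ?S}"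
        by (simp add: linear_0[OF G] span_zero zero_prod_def[symmetric])
      show "x + y \<in> {x. (x, 0) \<in> ?S \<and> (0, G x) \<in> ?S}"
        if "x \<in> {x. (x, 0) \<in> ?S \<and> (0, G x) \<in> ?S}" "y \<in> {x. (x, 0) \<in> ?S \<and> (0, G x) \<in> ?S}" for x y
        using that span_add[of "(x, 0)" _ "(y, 0)"] span_add[of "(0, G x)" _ "(0, G y)"]
        by (auto simp: linear_add[OF G])
      show "c *\<^sub>R x \<in> {x. (x, 0) \<in> ?S \<and> (0, G x) \<in> ?S}"
        if "x \<in> {x. (x, 0) \<in> ?S \<and> (0, G x) \<in> ?S}" for x c
        using that span_scale[of "(x, 0)" _ c] span_scale[of "(0, G x)" _ c]
        by (auto simp: linear_scale[OF G])
    qed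
    moreover have "?E \<subseteq> {x. (x, 0) \<in> ?S \<and> (0, G x) \<in> ?S}" using eig by blast
    ultimately have "span ?E \<subseteq> {x. (x, 0) \<in> ?S \<and> (0, G x) \<in> ?S}"
      by (intro span_minimal)
    moreover have "span ?E = UNIV"
      using symmetric_span_eigenvectors[of "\<lambda>x. adjoint G (G x)"] gram_symmetric
        linear_compose[OF G adjoint_linear[OF G]] by (simp add: o_def)
    ultimately show ?thesis by blast
  qed
  have "(0, q) \<in> ?S" for q
  proof -
    \<comment> \<open>The part \<open>w\<close> orthogonal to the range of \<open>G\<close> is
      killed by the adjoint and relaxes at rate \<open>1 / \<delta>\<close>.\<close>
    obtain g w where g: "g \<in> span (range G)" and w: "\<And>y. y \<in> span (range G) \<Longrightarrow> orthogonal w y"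
      and q: "q = g + w"
      using orthogonal_subspace_decomp_exists[of "range G" q] by metis
    have "adjoint G w \<bullet> x = 0" for x
      using w[of "G x"] by (simp add: adjoint_clauses[OF G] span_base orthogonal_def)
    then have "adjoint G w = 0"
      using inner_eq_zero_iff by blast
    then have "relax \<delta> (0, w) = (- 1 / \<delta>) *\<^sub>R (0, w)"
      by (simp add: relax_op_def linear_0[OF G])
    then have "(0, w) \<in> ?S"
      using \<delta> by (intro span_base) (auto simp: nonpos_eigenvectors_def intro!: exI[of _ "- 1 / \<delta>"])
    moreover have "g \<in> range G"
      using g linear_subspace_image[OF G subspace_UNIV] by (metis span_eq_iff)
    then have "(0, g) \<in> ?S" using all by auto
    ultimately show ?thesis
      using span_add[of "(0, g)" _ "(0, w)"] by (simp add: q)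
  qed
  then have "(x, q) \<in> ?S" for x q
    using span_add[of "(x, 0)" _ "(0, q)"] all[of x] by simp
  then show ?thesis by auto
qed

text \<open>\<open>l\<close> times this coefficient is the expansion of
  \<open>slow_ev a \<delta> l\<close> in \<delta>, cut after \<open>\<delta>^3\<close>.\<close>

lemma init_flux_eigen:
  assumes b: "adjoint G (G b) = l *\<^sub>R b"
  shows "init_flux a \<delta> G b = - (a + a\<^sup>2 * \<delta> * l + 2 * a^3 * \<delta>\<^sup>2 * l\<^sup>2 + 5 * a^4 * \<delta>^3 * l^3) *\<^sub>R G b"
proof -
  have "((adjoint G \<circ> G) ^^ k) b = l^k *\<^sub>R b" for k
    using b by (intro funpow_eigen linear_compose[OF G adjoint_linear[OF G]]) simp
  from this[of 2] this[of 3] show ?thesis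
    using b unfolding init_flux_def
    by (simp add: linear_scale[OF G] algebra_simps)
qed

lemma linear_init: "linear (\<lambda>u. (u, init_flux a \<delta> G u))"
proof -
  have L: "linear (\<lambda>u. G (((adjoint G \<circ> G) ^^ k) u))" for k
    using linear_compose[OF funpow_linear[OF linear_compose[OF G adjoint_linear[OF G]]] G, of k]
    by (simp add: o_def)
  have L1: "linear (\<lambda>u. G ((adjoint G \<circ> G) u))"
    using L[of 1] by (simp add: o_def)
  have "linear (init_flux a \<delta> G)"
    unfolding init_flux_def[abs_def]
    by (intro linear_compose_sub linear_compose_scale_right L L1 G)
  then show ?thesis
    by (intro linearI) (auto simp: linear_add linear_scale)
qed

end

subsection \<open>Error bounds uniform in the relaxation parameter\<close>

text \<open>Kept as a map of the initial value because it is linear in it, so that data can be split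
  into eigenvectors.\<close>

definition relax_error ::
  "real \<Rightarrow> ('x::euclidean_space \<Rightarrow> 'q::euclidean_space) \<Rightarrow> real \<Rightarrow> real \<Rightarrow> real \<Rightarrow> nat \<Rightarrow> 'x \<times> 'q \<Rightarrow> 'x \<times> 'q"
where
  "relax_error a G C \<delta> t n U =
     (R_op C (\<lambda>U. t *\<^sub>R relax_op a \<delta> G (\<lambda>q. - adjoint G q) U) ^^ n) U
     - op_exp (\<lambda>U. (real n * t) *\<^sub>R relax_op a \<delta> G (\<lambda>q. - adjoint G q) U) U"

context
  fixes G :: "'x::euclidean_space \<Rightarrow> 'q::euclidean_space" and a \<delta>0 :: real
  assumes G: "linear G" and a: "a > 0" and \<delta>0: "\<delta>0 > 0"
    and small: "4 * a * \<delta>0 * (sigma_max G)\<^sup>2 < 1"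
begin

lemma small_delta:
  assumes "\<delta> \<in> {0<..\<delta>0}"
  shows "4 * a * \<delta> * (sigma_max G)\<^sup>2 < 1"
proof -
  have "4 * a * \<delta> * (sigma_max G)\<^sup>2 \<le> 4 * a * \<delta>0 * (sigma_max G)\<^sup>2"
    using assms a by (intro mult_right_mono mult_left_mono) auto
  then show ?thesis using small by simp
qed

lemma span_relax:
  "\<delta> \<in> {0<..\<delta>0} \<Longrightarrow> span (nonpos_eigenvectors (relax_op a \<delta> G (\<lambda>q. - adjoint G q))) = UNIV"
  using span_relax_eigenvectors[OF G a] small_delta by simp

lemma linear_relax_error:
  assumes C: "1/78 \<le> C" and \<delta>: "\<delta> \<in> {0<..\<delta>0}" and t: "t > 0"
  shows "linear (relax_error a G C \<delta> t n)"
  unfolding relax_error_def[abs_def] using assms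
  by (intro linear_compose_sub funpow_linear linear_R_op linear_op_exp linear_compose_scale_right
      linear_relax[OF G a] span_nonpos_eigenvectors_scale span_relax) auto

lemma relax_error_eigenvector:
  assumes C: "1/78 \<le> C" "C \<le> 2/39" and \<delta>: "\<delta> \<in> {0<..\<delta>0}" and t: "t > 0"
    and b: "adjoint G (G b) = l *\<^sub>R b" "l > 0" "4 * a * \<delta> * l < 1"
    and z: "z \<in> {slow_ev a \<delta> l, fast_ev a \<delta> l}"
  shows "norm (relax_error a G C \<delta> t n (b, (z / l) *\<^sub>R G b))
    \<le> 8 * t^4 * z^4 * (norm b + \<bar>z / l\<bar> * norm (G b))"
proof -
  have ev: "z\<^sup>2 + z / \<delta> + a * l / \<delta> = 0"
    using \<delta> b z by (intro relax_ev_quadratic) auto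
  have "z \<le> 0" using relax_ev_bounds(1,2)[of \<delta> a l] \<delta> b a z by auto
  then have "norm (relax_error a G C \<delta> t n (b, (z / l) *\<^sub>R G b))
      \<le> 8 * t^4 * z^4 * norm (b, (z / l) *\<^sub>R G b)"
    unfolding relax_error_def using b(2) \<delta>
    by (intro eigenvector_error linear_relax[OF G a] span_relax C t relax_eigenvector[OF G a b(1) _ ev]) auto
  also have "\<dots> \<le> 8 * t^4 * z^4 * (norm b + \<bar>z / l\<bar> * norm (G b))"
    using norm_Pair_le[of b "(z / l) *\<^sub>R G b"] by (intro mult_left_mono) auto
  finally show ?thesis .
qed

text \<open>The data equal \<open>1 - c\<close> times the slow eigenvector plus \<open>c\<close>
  times the fast one, and \<open>K\<close> is such that
  \<open>\<bar>c\<bar> \<le> K * \<delta>^5\<close>. The two summands of the bound are the slow and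
  the fast contribution.\<close>

lemma init_error_gram_eigenvector:
  assumes b: "adjoint G (G b) = l *\<^sub>R b" "l > 0" "b \<noteq> 0"
    and C: "1/78 \<le> C" "C \<le> 2/39" and \<delta>: "\<delta> \<in> {0<..\<delta>0}" and t: "t > 0"
    and K: "K = 600 * (a * l)^5 / sqrt (1 - 4 * a * \<delta>0 * l)"
  shows "norm (relax_error a G C \<delta> t n (b, init_flux a \<delta> G b))
    \<le> (8 * (1 + K * \<delta>0^5) * (2 * a * l)^4 * (norm b + 2 * a * norm (G b))
        + 8 * K * (\<delta>0 * norm b + norm (G b) / l)) * t^4"
proof -
  let ?E = "relax_error a G C \<delta> t n"
  define \<mu> where "\<mu> = slow_ev a \<delta> l"
  define \<nu> where "\<nu> = fast_ev a \<delta> l"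
  \<comment> \<open>The value at \<delta>0 bounds \<open>s\<close> from below for all admissible
    \<delta>, which keeps \<open>K\<close> independent of \<delta>.\<close>
  define s0 where "s0 = sqrt (1 - 4 * a * \<delta>0 * l)"
  define s where "s = sqrt (1 - 4 * a * \<delta> * l)"
  define \<beta> where "\<beta> = - (a + a\<^sup>2 * \<delta> * l + 2 * a^3 * \<delta>\<^sup>2 * l\<^sup>2 + 5 * a^4 * \<delta>^3 * l^3)"
  have \<delta>': "0 < \<delta>" "\<delta> \<le> \<delta>0" using \<delta> by auto
  have l\<sigma>: "l \<le> (sigma_max G)\<^sup>2" using gram_eigenvalue_le_sigma_max[OF G a b(1,3)] .
  have "4 * a * \<delta>0 * l \<le> 4 * a * \<delta>0 * (sigma_max G)\<^sup>2"
    using l\<sigma> a \<delta>0 by (intro mult_left_mono) auto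
  then have sm0: "4 * a * \<delta>0 * l < 1" using small by simp
  have le: "4 * a * \<delta> * l \<le> 4 * a * \<delta>0 * l"
    using a b \<delta>' by (intro mult_right_mono mult_left_mono) auto
  then have sm: "4 * a * \<delta> * l < 1" using sm0 by simp
  have s0: "0 < s0" "s0 \<le> s" using sm0 le by (auto simp: s0_def s_def)
  have K0: "K \<ge> 0" unfolding K using a b s0 by (simp add: s0_def)
  note bounds = relax_ev_bounds[OF \<delta>'(1) sm less_imp_le[OF a] less_imp_le[OF b(2)],
      folded \<mu>_def \<nu>_def s_def]
  have gap: "\<nu> - \<mu> = - (s / \<delta>)" using bounds(5) by simp
  \<comment> \<open>Solves \<open>(1 - c) * \<mu> + c * \<nu> = l * \<beta>\<close>, the matching of
    the flux components.\<close>
  define c where "c = (l * \<beta> - \<mu>) / (\<nu> - \<mu>)"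
  have cgap: "c * (\<nu> - \<mu>) = l * \<beta> - \<mu>" using gap s0 \<delta>' by (simp add: c_def)
  have cat: "\<bar>l * \<beta> - \<mu>\<bar> \<le> 600 * (a * l)^5 * \<delta>^4"
  proof -
    \<comment> \<open>In this variable \<open>\<mu>\<close> and \<open>l * \<beta>\<close> are
      \<open>- 1 / \<delta>\<close> times the closed form and the truncation of the Catalan series,
      so their difference is of order \<open>y^5 / \<delta>\<close>.\<close>
    define y where "y = a * \<delta> * l"
    have y: "0 \<le> y" "4 * y \<le> 1" using a b \<delta>' sm by (auto simp: y_def)
    have "l * \<beta> = - (y + y\<^sup>2 + 2 * y^3 + 5 * y^4) / \<delta>"
      unfolding \<beta>_def y_def using \<delta>' by (simp add: field_simps eval_nat_numeral)
    moreover have "\<mu> = - ((1 - sqrt (1 - 4 * y)) / 2) / \<delta>"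
      unfolding \<mu>_def slow_ev_def y_def using \<delta>' by (simp add: field_simps)
    ultimately have "l * \<beta> - \<mu> = ((1 - sqrt (1 - 4 * y)) / 2 - (y + y\<^sup>2 + 2 * y^3 + 5 * y^4)) / \<delta>"
      by (simp only: diff_divide_distrib minus_divide_left[symmetric])
    then have "\<bar>l * \<beta> - \<mu>\<bar> \<le> 600 * y^5 / \<delta>"
      using catalan_bound[OF y] \<delta>' by (simp add: divide_right_mono)
    also have "\<dots> = 600 * (a * l)^5 * \<delta>^4"
      unfolding y_def using \<delta>' by (simp add: field_simps eval_nat_numeral)
    finally show ?thesis .
  qed
  have c: "\<bar>c\<bar> \<le> K * \<delta>^5"
  proof -
    \<comment> \<open>Division by the spectral gap \<open>s / \<delta>\<close> raises
      \<open>\<delta>^4\<close> to \<open>\<delta>^5\<close>.\<close>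
    have "\<bar>c\<bar> = \<bar>l * \<beta> - \<mu>\<bar> * \<delta> / s"
      unfolding c_def gap using \<delta>' s0 by (simp add: abs_mult)
    also have "\<dots> \<le> (600 * (a * l)^5 * \<delta>^4) * \<delta> / s0"
      using cat \<delta>' s0 a b by (intro frac_le mult_right_mono mult_nonneg_nonneg) auto
    also have "\<dots> = K * \<delta>^5" by (simp add: K s0_def eval_nat_numeral)
    finally show ?thesis .
  qed
  have "((1 - c) * \<mu> + c * \<nu>) / l = \<beta>"
    using cgap b(2) by (simp add: field_simps)
  then have "(b, init_flux a \<delta> G b)
      = (1 - c) *\<^sub>R (b, (\<mu> / l) *\<^sub>R G b) + c *\<^sub>R (b, (\<nu> / l) *\<^sub>R G b)"
    unfolding init_flux_eigen[OF G a b(1)] \<beta>_def[symmetric]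
    by (simp add: scaleR_add_left[symmetric] add_divide_distrib)
  then have "norm (?E (b, init_flux a \<delta> G b))
      = norm ((1 - c) *\<^sub>R ?E (b, (\<mu> / l) *\<^sub>R G b) + c *\<^sub>R ?E (b, (\<nu> / l) *\<^sub>R G b))"
    by (simp only: linear_add[OF linear_relax_error[OF C(1) \<delta> t]]
        linear_scale[OF linear_relax_error[OF C(1) \<delta> t]])
  also have "\<dots> \<le> \<bar>1 - c\<bar> * norm (?E (b, (\<mu> / l) *\<^sub>R G b)) + \<bar>c\<bar> * norm (?E (b, (\<nu> / l) *\<^sub>R G b))"
    by (rule order.trans[OF norm_triangle_ineq]) simp
  also have "\<bar>1 - c\<bar> * norm (?E (b, (\<mu> / l) *\<^sub>R G b))
      \<le> (1 + K * \<delta>0^5) * (8 * t^4 * (2 * a * l)^4 * (norm b + 2 * a * norm (G b)))"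
  proof (rule mult_mono)
    have "K * \<delta>^5 \<le> K * \<delta>0^5" using K0 \<delta>' by (intro mult_left_mono power_mono) auto
    then show "\<bar>1 - c\<bar> \<le> 1 + K * \<delta>0^5" using c by linarith
    have "\<bar>\<mu> / l\<bar> \<le> 2 * a" using bounds(3) b(2) by (simp add: divide_le_eq)
    moreover have "\<mu>^4 \<le> (2 * a * l)^4"
      using power_mono[OF bounds(3), of 4] by simp
    ultimately have "8 * t^4 * \<mu>^4 * (norm b + \<bar>\<mu> / l\<bar> * norm (G b))
        \<le> 8 * t^4 * (2 * a * l)^4 * (norm b + 2 * a * norm (G b))"
      using a b by (intro mult_mono add_mono mult_left_mono mult_right_mono) auto
    then show "norm (?E (b, (\<mu> / l) *\<^sub>R G b)) \<le> 8 * t^4 * (2 * a * l)^4 * (norm b + 2 * a * norm (G b))"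
      using relax_error_eigenvector[OF C \<delta> t b(1,2) sm, of \<mu> n] by (simp add: \<mu>_def)
  qed (use K0 \<delta>0 in auto)
  also have "\<bar>c\<bar> * norm (?E (b, (\<nu> / l) *\<^sub>R G b)) \<le> 8 * K * (\<delta>0 * norm b + norm (G b) / l) * t^4"
  proof -
    have "\<nu>^4 \<le> (1 / \<delta>)^4"
      using power_mono[OF bounds(4), of 4] by simp
    moreover have "\<bar>\<nu> / l\<bar> \<le> 1 / \<delta> / l"
      using divide_right_mono[OF bounds(4), of l] b(2) by simp
    ultimately have "8 * t^4 * \<nu>^4 * (norm b + \<bar>\<nu> / l\<bar> * norm (G b))
        \<le> 8 * t^4 * (1 / \<delta>)^4 * (norm b + 1 / \<delta> / l * norm (G b))"
      using \<delta>' b by (intro mult_mono add_mono mult_left_mono mult_right_mono) auto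
    then have "norm (?E (b, (\<nu> / l) *\<^sub>R G b)) \<le> 8 * t^4 * (1 / \<delta>)^4 * (norm b + 1 / \<delta> / l * norm (G b))"
      using relax_error_eigenvector[OF C \<delta> t b(1,2) sm, of \<nu> n] by (simp add: \<nu>_def)
    with c have "\<bar>c\<bar> * norm (?E (b, (\<nu> / l) *\<^sub>R G b))
        \<le> (K * \<delta>^5) * (8 * t^4 * (1 / \<delta>)^4 * (norm b + 1 / \<delta> / l * norm (G b)))"
      using K0 \<delta>' by (intro mult_mono) auto
    \<comment> \<open>The factor \<open>\<delta>^5\<close> absorbs \<open>\<delta>^-4\<close> from
      \<open>\<nu>^4\<close> and, in the flux component, one more \<open>1 / \<delta>\<close> from
      \<open>\<nu> / l\<close>.\<close>
    also have "\<dots> = 8 * K * (\<delta> * norm b + norm (G b) / l) * t^4"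
      using \<delta>' b(2) by (simp add: field_simps eval_nat_numeral)
    also have "\<dots> \<le> 8 * K * (\<delta>0 * norm b + norm (G b) / l) * t^4"
      using \<delta>' K0 by (intro mult_right_mono mult_left_mono add_mono) auto
    finally show ?thesis .
  qed
  finally show ?thesis by (simp add: algebra_simps)
qed

section \<open>From Gram eigenvectors to arbitrary initial data\<close>

definition uniform_fourth_order :: "'x \<Rightarrow> bool" where
  "uniform_fourth_order u \<longleftrightarrow> (\<exists>K\<ge>0. \<forall>C\<in>{1/78..2/39}. \<forall>\<delta>\<in>{0<..\<delta>0}. \<forall>t>0. \<forall>n.
     norm (relax_error a G C \<delta> t n (u, init_flux a \<delta> G u)) \<le> K * t^4)"

lemma linear_init_error:
  assumes "1/78 \<le> C" "\<delta> \<in> {0<..\<delta>0}" "t > 0"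
  shows "linear (\<lambda>u. relax_error a G C \<delta> t n (u, init_flux a \<delta> G u))"
  using linear_compose[OF linear_init[OF G a] linear_relax_error[OF assms]] by (simp add: o_def)

lemma uniform_fourth_order_gram_eigenvector:
  assumes b: "adjoint G (G b) = l *\<^sub>R b"
  shows "uniform_fourth_order b"
proof (cases "b = 0 \<or> l = 0")
  \<comment> \<open>Now \<open>G b = 0\<close>: the prepared flux vanishes and \<open>(b, 0)\<close>
    has eigenvalue 0, so there is no error at all.\<close>
  case True
  then have Gb: "G b = 0" using gram_eigenvalue[OF G a b] by auto
  have "norm (relax_error a G C \<delta> t n (b, init_flux a \<delta> G b)) \<le> 0"
    if "C \<in> {1/78..2/39}" "\<delta> \<in> {0<..\<delta>0}" "t > 0" for C \<delta> t n
  proof -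
    have "adjoint G (G b) = 0 *\<^sub>R b"
      by (simp add: Gb linear_0[OF adjoint_linear[OF G]])
    from init_flux_eigen[OF G a this, of \<delta>] have "init_flux a \<delta> G b = 0"
      by (simp add: Gb)
    moreover have "norm (relax_error a G C \<delta> t n (b, 0)) \<le> 8 * t^4 * 0^4 * norm (b, 0::'q)"
      unfolding relax_error_def using that
      by (intro eigenvector_error linear_relax[OF G a] span_relax)
        (auto simp: relax_op_def Gb linear_0[OF adjoint_linear[OF G]] zero_prod_def)
    ultimately show ?thesis by simp
  qed
  then show ?thesis
    unfolding uniform_fourth_order_def by (intro exI[of _ 0]) auto
next
  case False
  then have l: "l > 0" "b \<noteq> 0" using gram_eigenvalue_nonneg[OF G a b] by auto
  define K where "K = 600 * (a * l)^5 / sqrt (1 - 4 * a * \<delta>0 * l)"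
  define K' where "K' = 8 * (1 + K * \<delta>0^5) * (2 * a * l)^4 * (norm b + 2 * a * norm (G b))
        + 8 * K * (\<delta>0 * norm b + norm (G b) / l)"
  have "norm (relax_error a G C \<delta> t n (b, init_flux a \<delta> G b)) \<le> max 0 K' * t^4"
    if "C \<in> {1/78..2/39}" "\<delta> \<in> {0<..\<delta>0}" "t > 0" for C \<delta> t n
  proof -
    have "norm (relax_error a G C \<delta> t n (b, init_flux a \<delta> G b)) \<le> K' * t^4"
      unfolding K'_def using init_error_gram_eigenvector[OF b l _ _ that(2,3) K_def] that(1) by simp
    also have "\<dots> \<le> max 0 K' * t^4" by (intro mult_right_mono) auto
    finally show ?thesis .
  qed
  then show ?thesis
    unfolding uniform_fourth_order_def by (intro exI[of _ "max 0 K'"]) auto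
qed

text \<open>The error is linear in the initial displacement, so constants add under sums and scale
  by \<open>\<bar>c\<bar>\<close>; Gram eigenvectors span.\<close>

lemma uniform_fourth_order_all: "uniform_fourth_order u"
proof -
  have "subspace {u. uniform_fourth_order u}"
  proof (rule subspaceI)
    have "adjoint G (G 0) = 0 *\<^sub>R (0::'x)"
      by (simp add: linear_0[OF G] linear_0[OF adjoint_linear[OF G]])
    then show "0 \<in> {u. uniform_fourth_order u}"
      using uniform_fourth_order_gram_eigenvector by blast
  next
    fix x y assume "x \<in> {u. uniform_fourth_order u}" "y \<in> {u. uniform_fourth_order u}"
    then obtain K L where "K \<ge> 0" "L \<ge> 0"
      and K: "\<And>C \<delta> t n. C \<in> {1/78..2/39} \<Longrightarrow> \<delta> \<in> {0<..\<delta>0} \<Longrightarrow> t > 0 \<Longrightarrow>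
        norm (relax_error a G C \<delta> t n (x, init_flux a \<delta> G x)) \<le> K * t^4"
      and L: "\<And>C \<delta> t n. C \<in> {1/78..2/39} \<Longrightarrow> \<delta> \<in> {0<..\<delta>0} \<Longrightarrow> t > 0 \<Longrightarrow>
        norm (relax_error a G C \<delta> t n (y, init_flux a \<delta> G y)) \<le> L * t^4"
      unfolding uniform_fourth_order_def mem_Collect_eq by metis
    moreover have "norm (relax_error a G C \<delta> t n (x + y, init_flux a \<delta> G (x + y))) \<le> (K + L) * t^4"
      if "C \<in> {1/78..2/39}" "\<delta> \<in> {0<..\<delta>0}" "t > 0" for C \<delta> t n
      using linear_add[OF linear_init_error[of C \<delta> t n], of x y] K[OF that, of n] L[OF that, of n] that
      by (auto simp: distrib_right intro!: norm_triangle_le)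
    ultimately show "x + y \<in> {u. uniform_fourth_order u}"
      unfolding uniform_fourth_order_def mem_Collect_eq by (intro exI[of _ "K + L"]) auto
  next
    fix c x assume "x \<in> {u. uniform_fourth_order u}"
    then obtain K where "K \<ge> 0"
      and K: "\<And>C \<delta> t n. C \<in> {1/78..2/39} \<Longrightarrow> \<delta> \<in> {0<..\<delta>0} \<Longrightarrow> t > 0 \<Longrightarrow>
        norm (relax_error a G C \<delta> t n (x, init_flux a \<delta> G x)) \<le> K * t^4"
      unfolding uniform_fourth_order_def mem_Collect_eq by metis
    moreover have "norm (relax_error a G C \<delta> t n (c *\<^sub>R x, init_flux a \<delta> G (c *\<^sub>R x))) \<le> (\<bar>c\<bar> * K) * t^4"
      if "C \<in> {1/78..2/39}" "\<delta> \<in> {0<..\<delta>0}" "t > 0" for C \<delta> t n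
      using linear_scale[OF linear_init_error[of C \<delta> t n], of c x]
        mult_left_mono[OF K[OF that, of n], of "\<bar>c\<bar>"] that by (auto simp: mult.assoc)
    ultimately show "c *\<^sub>R x \<in> {u. uniform_fourth_order u}"
      unfolding uniform_fourth_order_def mem_Collect_eq by (intro exI[of _ "\<bar>c\<bar> * K"]) auto
  qed
  moreover have "{b. \<exists>l. adjoint G (G b) = l *\<^sub>R b} \<subseteq> {u. uniform_fourth_order u}"
    using uniform_fourth_order_gram_eigenvector by blast
  ultimately have "span {b. \<exists>l. adjoint G (G b) = l *\<^sub>R b} \<subseteq> {u. uniform_fourth_order u}"
    by (intro span_minimal)
  moreover have "span {b. \<exists>l. adjoint G (G b) = l *\<^sub>R b} = UNIV"
    using symmetric_span_eigenvectors[of "\<lambda>x. adjoint G (G x)"] gram_symmetric[OF G a]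
      linear_compose[OF G adjoint_linear[OF G]] by (simp add: o_def)
  ultimately show ?thesis by blast
qed

text \<open>Makes the constant proportional to \<open>norm u\<close>: expand \<open>u\<close> in the
  finite basis, sum the constants of the basis vectors and bound each coordinate by
  \<open>norm u\<close>.\<close>

lemma init_error_bound:
  obtains K where "K \<ge> 0"
    "\<And>C \<delta> t n u. C \<in> {1/78..2/39} \<Longrightarrow> \<delta> \<in> {0<..\<delta>0} \<Longrightarrow> t > 0 \<Longrightarrow>
       norm (relax_error a G C \<delta> t n (u, init_flux a \<delta> G u)) \<le> K * norm u * t^4"
proof -
  have "\<forall>i. \<exists>k\<ge>0. \<forall>C\<in>{1/78..2/39}. \<forall>\<delta>\<in>{0<..\<delta>0}. \<forall>t>0. \<forall>n.
      norm (relax_error a G C \<delta> t n (i, init_flux a \<delta> G i)) \<le> k * t^4"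
    using uniform_fourth_order_all unfolding uniform_fourth_order_def by blast
  then obtain k where k0: "\<And>i. k i \<ge> 0"
    and k: "\<And>i C \<delta> t n. C \<in> {1/78..2/39} \<Longrightarrow> \<delta> \<in> {0<..\<delta>0} \<Longrightarrow> t > 0 \<Longrightarrow>
      norm (relax_error a G C \<delta> t n (i, init_flux a \<delta> G i)) \<le> k i * t^4"
    unfolding choice_iff by blast
  show thesis
  proof
    show "(\<Sum>i\<in>Basis. k i) \<ge> 0" by (intro sum_nonneg k0)
    fix C \<delta> t :: real and n :: nat and u :: 'x
    assume *: "C \<in> {1/78..2/39}" "\<delta> \<in> {0<..\<delta>0}" "t > (0::real)"
    let ?E = "\<lambda>u. relax_error a G C \<delta> t n (u, init_flux a \<delta> G u)"
    have kE: "norm (?E i) \<le> k i * t^4" for i by (rule k[OF *])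
    have lin: "linear ?E" using * by (intro linear_init_error) auto
    have "?E u = ?E (\<Sum>i\<in>Basis. (u \<bullet> i) *\<^sub>R i)" by (simp only: euclidean_representation)
    also have "\<dots> = (\<Sum>i\<in>Basis. (u \<bullet> i) *\<^sub>R ?E i)"
      by (simp only: linear_sum[OF lin] linear_scale[OF lin])
    also have "norm \<dots> \<le> (\<Sum>i\<in>Basis. norm u * (k i * t^4))"
      using kE Basis_le_norm
      by (intro order.trans[OF norm_sum sum_mono]) (auto intro!: mult_mono)
    also have "\<dots> = (\<Sum>i\<in>Basis. k i) * norm u * t^4"
      by (simp add: sum_distrib_left sum_distrib_right mult_ac)
    finally show "norm (?E u) \<le> (\<Sum>i\<in>Basis. k i) * norm u * t^4" .
  qed
qed

end

theorem proposition5: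
  fixes G :: "'x::euclidean_space \<Rightarrow> 'q::euclidean_space"
    and D :: "'q \<Rightarrow> 'x"
    and a \<delta>0 T B :: real
  assumes "a > 0"
    and "linear G"
    and "linear D"
    and "D = (\<lambda>q. - adjoint G q)"
    and "\<delta>0 > 0"
    and "4 * a * \<delta>0 * (sigma_max G)\<^sup>2 < 1"
    and "T > 0"
  shows "\<exists>K. \<forall>C\<in>{C_minus..C_plus}. \<forall>u0. norm u0 \<le> B \<longrightarrow>
           (\<forall>\<delta>\<in>{0<..\<delta>0}. \<forall>\<Delta>t>0. \<forall>n. real n * \<Delta>t \<le> T \<longrightarrow>
              norm (((R_op C (\<lambda>U. \<Delta>t *\<^sub>R relax_op a \<delta> G D U)) ^^ n) (u0, init_flux a \<delta> G u0)
                    - op_exp (\<lambda>U. (real n * \<Delta>t) *\<^sub>R relax_op a \<delta> G D U) (u0, init_flux a \<delta> G u0))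
              \<le> K * \<Delta>t ^ 4)"
proof -
  obtain K where K0: "K \<ge> 0" and K: "\<And>C \<delta> t n u. C \<in> {1/78..2/39} \<Longrightarrow> \<delta> \<in> {0<..\<delta>0} \<Longrightarrow> t > 0 \<Longrightarrow>
      norm (relax_error a G C \<delta> t n (u, init_flux a \<delta> G u)) \<le> K * norm u * t^4"
    using init_error_bound[OF assms(2,1,5,6)] by blast
  show ?thesis
  \<comment> \<open>The constant dominates \<open>K * norm u0\<close> on the whole ball of radius
    \<open>B\<close>.\<close>
  proof (intro exI[of _ "K * B"] ballI allI impI)
    fix C \<delta> \<Delta>t :: real and u0 :: 'x and n :: nat
    assume C: "C \<in> {C_minus..C_plus}" and u0: "norm u0 \<le> B" and \<delta>: "\<delta> \<in> {0<..\<delta>0}"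
      and t: "(0::real) < \<Delta>t"
    have "norm (relax_error a G C \<delta> \<Delta>t n (u0, init_flux a \<delta> G u0)) \<le> K * norm u0 * \<Delta>t^4"
      using C_bounds[OF C] by (intro K \<delta> t) auto
    also have "\<dots> \<le> K * B * \<Delta>t^4"
      using u0 K0 by (intro mult_right_mono mult_left_mono) auto
    finally show "norm (((R_op C (\<lambda>U. \<Delta>t *\<^sub>R relax_op a \<delta> G D U)) ^^ n) (u0, init_flux a \<delta> G u0)
                    - op_exp (\<lambda>U. (real n * \<Delta>t) *\<^sub>R relax_op a \<delta> G D U) (u0, init_flux a \<delta> G u0))
              \<le> K * B * \<Delta>t ^ 4"
      unfolding relax_error_def assms(4) .
  qed
qed

end
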